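(* Let $n\ge4$ and let $S$ be an inductive strategy of length $n$. Then the number of permutations $\pi\in S_n$ such that the game with strategy $S$ and secret $\pi$ ends after exactly three guesses and $\rho_S(\pi)=1$ equals \[1-2^{n+1}+3^n+\frac{n^2}{2}+\frac{5n}{2}-n\cdot2^n.\]
   Context: Permutation wordle on $[n]=\{1,\dots,n\}$: a secret permutation $\pi\in S_n$ (one-line notation) is fixed. The first guess is $\gamma_1=[1,2,\dots,n]$. After guess $\gamma_r$ the guesser learns $\mathcal{J}_r=\{i:\gamma_r(i)=\pi(i)\}$; $\mathcal{I}_r=[n]\setminus\mathcal{J}_r$. The game ends at the first $r$ with $\mathcal{J}_r=[n]$. A strategy of length $n$ is a sequence $S=(S[1],\dots,S[n])$ with $S[k]$ a permutation of $[k]$; if $\mathcal{I}_r=\{i_1<\dots<i_k\}\neq\emptyset$ and $\sigma=S[k]$, then $\gamma_{r+1}(i)=\gamma_r(i)$ for $i\in\mathcal{J}_r$ and $\gamma_{r+1}(i_{\sigma(j)})=\gamma_r(i_j)$ for $j=1,\dots,k$. The cyclic shift strategy $CS$ has $CS[k]=[2,3,\dots,k,1]$. An inductive strategy of length $n$ has $S[k]=CS[k]$ for $1\le k\le n-1$ and $S[n]$ an arbitrary cyclic permutation (single $n$-cycle) of $[n]$. For a secret $\pi$, $\rho_S(\pi)=\min\{i:\mathcal{J}_i\neq\emptyset\}$, the index of the first guess having at least one correct position. *)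

theory Defs
  imports Complex_Main "HOL-Combinatorics.Cycles"
begin

text \<open>
  A permutation of $[n]$ is a function \<open>p\<close> with \<open>p permutes {1..n}\<close>. Such a function is the
  identity outside $[n]$, so permutations of $[n]$ correspond one-to-one to these functions.
  A sequence $(S[1],\dots,S[n])$ is a function on the natural numbers of which only the values
  at $1,\dots,n$ are used.
\<close>

definition correct_positions :: "nat \<Rightarrow> (nat \<Rightarrow> nat) \<Rightarrow> (nat \<Rightarrow> nat) \<Rightarrow> nat set" where
  "correct_positions n \<pi> \<gamma> = {i \<in> {1..n}. \<gamma> i = \<pi> i}"

definition incorrect_positions :: "nat \<Rightarrow> (nat \<Rightarrow> nat) \<Rightarrow> (nat \<Rightarrow> nat) \<Rightarrow> nat set" where
  "incorrect_positions n \<pi> \<gamma> = {1..n} - correct_positions n \<pi> \<gamma>"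

text \<open>The \<open>j\<close>-th smallest element $i_j$ of a finite set, counting from 1.\<close>

definition nth_smallest :: "nat set \<Rightarrow> nat \<Rightarrow> nat" where
  "nth_smallest I j = sorted_list_of_set I ! (j - 1)"

text \<open>
  With $I = \{i_1 < \dots < i_k\}$ and $\sigma$ a permutation of $[k]$, every \<open>i \<in> I\<close> is
  $i_{\sigma(j)}$ for exactly one $j \in [k]$, and the new value at \<open>i\<close> is the old value at $i_j$.
\<close>

definition move_incorrect ::
    "(nat \<Rightarrow> nat) \<Rightarrow> nat set \<Rightarrow> (nat \<Rightarrow> nat) \<Rightarrow> nat \<Rightarrow> nat" where
  "move_incorrect \<sigma> I \<gamma> i =
     (if i \<in> I
      then \<gamma> (nth_smallest I (THE j. j \<in> {1..card I} \<and> nth_smallest I (\<sigma> j) = i))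
      else \<gamma> i)"

definition next_guess ::
    "nat \<Rightarrow> (nat \<Rightarrow> nat \<Rightarrow> nat) \<Rightarrow> (nat \<Rightarrow> nat) \<Rightarrow> (nat \<Rightarrow> nat) \<Rightarrow> nat \<Rightarrow> nat" where
  "next_guess n S \<pi> \<gamma> =
     (let I = incorrect_positions n \<pi> \<gamma> in move_incorrect (S (card I)) I \<gamma>)"

text \<open>
  Guesses are numbered from 1; the value at 0 is a dummy. Once a guess equals the secret, the
  sequence stays constant.
\<close>

fun guess ::
    "nat \<Rightarrow> (nat \<Rightarrow> nat \<Rightarrow> nat) \<Rightarrow> (nat \<Rightarrow> nat) \<Rightarrow> nat \<Rightarrow> nat \<Rightarrow> nat" where
  "guess n S \<pi> 0 = id"
| "guess n S \<pi> (Suc 0) = id"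
| "guess n S \<pi> (Suc (Suc r)) = next_guess n S \<pi> (guess n S \<pi> (Suc r))"

definition correct_at ::
    "nat \<Rightarrow> (nat \<Rightarrow> nat \<Rightarrow> nat) \<Rightarrow> (nat \<Rightarrow> nat) \<Rightarrow> nat \<Rightarrow> nat set" where
  "correct_at n S \<pi> r = correct_positions n \<pi> (guess n S \<pi> r)"

definition game_ends_at ::
    "nat \<Rightarrow> (nat \<Rightarrow> nat \<Rightarrow> nat) \<Rightarrow> (nat \<Rightarrow> nat) \<Rightarrow> nat \<Rightarrow> bool" where
  "game_ends_at n S \<pi> r \<longleftrightarrow>
     1 \<le> r \<and> correct_at n S \<pi> r = {1..n} \<and> (\<forall>r'\<in>{1..<r}. correct_at n S \<pi> r' \<noteq> {1..n})"

text \<open>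
  If no guess ever has a correct position, the minimum does not exist and the value below is
  unspecified; this cannot happen in a game that ends on a nonempty $[n]$.
\<close>

definition first_hit :: "nat \<Rightarrow> (nat \<Rightarrow> nat \<Rightarrow> nat) \<Rightarrow> (nat \<Rightarrow> nat) \<Rightarrow> nat" where
  "first_hit n S \<pi> = (LEAST r. 1 \<le> r \<and> correct_at n S \<pi> r \<noteq> {})"

definition is_strategy :: "nat \<Rightarrow> (nat \<Rightarrow> nat \<Rightarrow> nat) \<Rightarrow> bool" where
  "is_strategy n S \<longleftrightarrow> (\<forall>k\<in>{1..n}. S k permutes {1..k})"

definition cyclic_shift :: "nat \<Rightarrow> nat \<Rightarrow> nat" where
  "cyclic_shift k i = (if i \<in> {1..k} then (if i = k then 1 else i + 1) else i)"

definition is_cyclic_permutation :: "nat \<Rightarrow> (nat \<Rightarrow> nat) \<Rightarrow> bool" where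
  "is_cyclic_permutation n p \<longleftrightarrow> (\<exists>cs. distinct cs \<and> set cs = {1..n} \<and> p = cycle_of_list cs)"

definition inductive_strategy :: "nat \<Rightarrow> (nat \<Rightarrow> nat \<Rightarrow> nat) \<Rightarrow> bool" where
  "inductive_strategy n S \<longleftrightarrow>
     is_strategy n S \<and> (\<forall>k\<in>{1..<n}. S k = cyclic_shift k) \<and> is_cyclic_permutation n (S n)"

end

theory Submission
  imports Defs
begin

text \<open>
  If the identity is correct somewhere but not everywhere, all later moves are cyclic shifts of
  proper subsets of $[n]$. Let $I$ be the support of the secret and $I' \subseteq I$ the set of
  positions where the second guess is wrong. The second guess is the cyclic predecessor map
  $p_I$ of $I$ and the third is $p_I \circ p_{I'}$. Hence the permutations to be counted are
  exactly the $p_I \circ p_{I'}$ for which $I$ and $I'$ can be recovered in this way. This only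
  needs $|I'| \ge 2$ and $p_I(p_{I'}(x)) \ne x$ on $I'$, and the latter fails precisely when $I'$
  consists of two cyclically adjacent elements of $I$. A set $I$ of size $k \ge 3$ thus admits
  $2^k - 1 - 2k$ choices of $I'$, and a smaller one admits none.
\<close>

section \<open>Cyclic predecessors\<close>

text \<open>The cyclic shift carries the value at a position of \<open>I\<close> to the next one, so
  the new guess at \<open>x\<close> reads the old guess at the predecessor of \<open>x\<close>.
  Stating this through the order instead of through indices reduces the later arguments to
  comparisons.\<close>

definition cyclic_pred :: "'a::linorder set \<Rightarrow> 'a \<Rightarrow> 'a" where
  "cyclic_pred I x =
     (if x \<in> I then (if x = Min I then Max I else Max {y \<in> I. y < x}) else x)"

lemma cyclic_pred_notin [simp]: "x \<notin> I \<Longrightarrow> cyclic_pred I x = x"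
  by (simp add: cyclic_pred_def)

lemma cyclic_pred_Min: "finite I \<Longrightarrow> I \<noteq> {} \<Longrightarrow> cyclic_pred I (Min I) = Max I"
  by (simp add: cyclic_pred_def)

lemma cyclic_pred_not_Min:
  assumes "finite I" "x \<in> I" "x \<noteq> Min I"
  shows "cyclic_pred I x \<in> I" "cyclic_pred I x < x"
    and "\<And>y. y \<in> I \<Longrightarrow> y < x \<Longrightarrow> y \<le> cyclic_pred I x"
proof -
  have "Min I \<in> I"
    using assms(1,2) Min_in by blast
  moreover have "Min I \<le> x"
    using assms by simp
  ultimately have "Min I \<in> I" "Min I < x"
    using assms(3) by auto
  then have "Max {y \<in> I. y < x} \<in> {y \<in> I. y < x}"
    using assms by (intro Max_in) auto
  then show "cyclic_pred I x \<in> I" "cyclic_pred I x < x"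
    using assms by (auto simp: cyclic_pred_def)
  show "y \<le> cyclic_pred I x" if "y \<in> I" "y < x" for y
    using that assms by (auto simp: cyclic_pred_def)
qed

lemma cyclic_pred_in: "finite I \<Longrightarrow> x \<in> I \<Longrightarrow> cyclic_pred I x \<in> I"
  by (metis Max_in cyclic_pred_Min cyclic_pred_not_Min(1) empty_iff)

text \<open>On a finite set injectivity is enough. For \<open>x < y\<close> in \<open>I\<close>, the
  step from \<open>y\<close> goes down. The step from \<open>x\<close> either wraps to the maximum,
  which is at least \<open>y\<close>, or lands below \<open>x\<close>, while the predecessor of
  \<open>y\<close> is at least \<open>x\<close>.\<close>

lemma cyclic_pred_permutes:
  assumes "finite I"
  shows "cyclic_pred I permutes I"
proof -
  have less: "cyclic_pred I x \<noteq> cyclic_pred I y" if "x \<in> I" "y \<in> I" "x < y" for x y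
  proof -
    have "y \<noteq> Min I"
      using that assms by (metis Min_le leD)
    note y = cyclic_pred_not_Min[OF assms that(2) this]
    show ?thesis
    proof (cases "x = Min I")
      case True
      then have "y \<le> cyclic_pred I x"
        using that assms cyclic_pred_Min[OF assms] by (metis Max_ge empty_iff)
      then show ?thesis
        using y(2) by auto
    next
      case False
      then show ?thesis
        using cyclic_pred_not_Min(2)[OF assms that(1) False] y(3)[OF that(1,3)] by auto
    qed
  qed
  then have "inj_on (cyclic_pred I) I"
    by (metis inj_onI linorder_neq_iff)
  moreover have "cyclic_pred I ` I \<subseteq> I"
    using cyclic_pred_in[OF assms] by auto
  ultimately have "bij_betw (cyclic_pred I) I I"
    using assms by (simp add: bij_betw_def endo_inj_surj)
  then show ?thesis
    by (rule bij_imp_permutes) simp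
qed

lemma cyclic_pred_neq:
  assumes "card I \<ge> 2" "x \<in> I"
  shows "cyclic_pred I x \<noteq> x"
proof (cases "x = Min I")
  case True
  have "finite I"
    using assms by (metis card.infinite not_numeral_le_zero)
  have "Min I \<noteq> Max I"
  proof
    assume "Min I = Max I"
    then have "I \<subseteq> {x}"
      using \<open>finite I\<close> True by (metis Max_ge Min_le insertI1 order_antisym subsetI)
    then have "card I \<le> 1"
      using card_mono[of "{x}" I] by simp
    then show False
      using assms by simp
  qed
  then show ?thesis
    using True \<open>finite I\<close> assms by (metis cyclic_pred_Min empty_iff)
next
  case False
  have "finite I"
    using assms by (metis card.infinite not_numeral_le_zero)
  then show ?thesis
    using cyclic_pred_not_Min(2)[OF _ assms(2) False] by auto
qed

lemma cyclic_pred_doubleton: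
  assumes "x \<noteq> y"
  shows "cyclic_pred {y, x} x = y"
proof -
  have "cyclic_pred {y, x} x \<in> {y, x}"
    by (rule cyclic_pred_in) auto
  moreover have "cyclic_pred {y, x} x \<noteq> x"
    using assms by (intro cyclic_pred_neq) auto
  ultimately show ?thesis
    by blast
qed

text \<open>
  Stepping back once in \<open>J\<close> and once more in a superset \<open>I\<close> returns to the start only after a full
  turn, so that \<open>J\<close> has no third element.
\<close>

lemma cyclic_pred_cyclic_pred_eq:
  assumes "finite I" "J \<subseteq> I" "card J \<ge> 2" "x \<in> J"
    and "cyclic_pred I (cyclic_pred J x) = x"
  shows "J = {cyclic_pred J x, x}"
proof -
  define y where "y = cyclic_pred J x"
  have "finite J"
    using assms finite_subset by blast
  have "y \<in> J" "y \<noteq> x" "x \<in> I" "y \<in> I"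
    using cyclic_pred_in[OF \<open>finite J\<close>] cyclic_pred_neq[of J] assms by (auto simp: y_def)
  have xy: "cyclic_pred I y = x"
    using assms y_def by simp
  have "J \<subseteq> {y, x}"
  proof (cases "x = Min J")
    case True
    have "y = Max J"
      using True assms \<open>finite J\<close> cyclic_pred_Min[of J] by (auto simp: y_def)
    have le: "x \<le> z" "z \<le> y" if "z \<in> J" for z
      using that True \<open>y = Max J\<close> \<open>finite J\<close> by auto
    \<comment> \<open>The step in \<open>J\<close> wraps around, so the step in \<open>I\<close>
      from \<open>y\<close> down to \<open>x\<close> does not. Hence no element of \<open>I\<close>
      lies strictly between \<open>x\<close> and \<open>y\<close>, whereas all of \<open>J\<close>
      lies between them.\<close>
    have "y \<noteq> Min I"
      using le(2)[OF \<open>x \<in> J\<close>] \<open>y \<noteq> x\<close> \<open>x \<in> I\<close> \<open>finite I\<close> Min_le[of I x] by (metis order_antisym)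
    note p = cyclic_pred_not_Min[OF \<open>finite I\<close> \<open>y \<in> I\<close> this, unfolded xy]
    show ?thesis
    proof
      fix z
      assume "z \<in> J"
      then have "z = y \<or> z \<le> x"
        using p(3)[of z] le(2)[of z] \<open>J \<subseteq> I\<close> by force
      then show "z \<in> {y, x}"
        using le(1)[OF \<open>z \<in> J\<close>] by auto
    qed
  next
    case False
    note q = cyclic_pred_not_Min[OF \<open>finite J\<close> \<open>x \<in> J\<close> this, folded y_def]
    \<comment> \<open>Here the step in \<open>J\<close> goes down from \<open>x\<close> to
      \<open>y\<close>, so the step in \<open>I\<close> from \<open>y\<close> up to \<open>x\<close>
      has to wrap around.\<close>
    have "y = Min I"
      using cyclic_pred_not_Min(2)[OF \<open>finite I\<close> \<open>y \<in> I\<close>] q(2) xy by force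
    then have "x = Max I"
      using cyclic_pred_Min[of I] xy \<open>finite I\<close> \<open>x \<in> I\<close> by auto
    show ?thesis
    proof
      fix z
      assume "z \<in> J"
      then have "y \<le> z" "z \<le> x"
        using \<open>y = Min I\<close> \<open>x = Max I\<close> \<open>finite I\<close> \<open>J \<subseteq> I\<close> by auto
      then show "z \<in> {y, x}"
        using q(3)[OF \<open>z \<in> J\<close>] by force
    qed
  qed
  then show ?thesis
    using \<open>y \<in> J\<close> \<open>x \<in> J\<close> by (auto simp: y_def)
qed

text \<open>Links the order-theoretic predecessor with the enumeration on which
  \<open>nth_smallest\<close> rests. The list is strictly increasing, so comparing entries is
  comparing indices, and the minimum, the maximum and the predecessor can be read off.\<close>

lemma cyclic_pred_sorted_nth:
  assumes "finite I" "m < card I"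
  shows "cyclic_pred I (sorted_list_of_set I ! m) =
         sorted_list_of_set I ! (if m = 0 then card I - 1 else m - 1)"
proof -
  let ?xs = "sorted_list_of_set I"
  have len: "length ?xs = card I" and set: "set ?xs = I"
    using assms by auto
  have mono: "?xs ! i < ?xs ! j \<longleftrightarrow> i < j" if "i < card I" "j < card I" for i j
    using that sorted_wrt_nth_less[OF strict_sorted_list_of_set, of _ _ I] len
    by (metis linorder_neqE_nat order_less_asym order_less_irrefl)
  have nth_in: "?xs ! i \<in> I" if "i < card I" for i
    using that len set nth_mem by metis
  have ex: "\<exists>i < card I. z = ?xs ! i" if "z \<in> I" for z
    using that len set by (metis in_set_conv_nth)
  have "I \<noteq> {}"
    using assms by auto
  have Min: "Min I = ?xs ! 0"
  proof (rule Min_eqI)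
    fix z assume "z \<in> I"
    then obtain i where "i < card I" "z = ?xs ! i"
      using ex by blast
    then show "?xs ! 0 \<le> z"
      using mono[of i 0] assms by (simp add: not_less[symmetric])
  qed (use assms nth_in in auto)
  have Max: "Max I = ?xs ! (card I - 1)"
  proof (rule Max_eqI)
    fix z assume "z \<in> I"
    then obtain i where "i < card I" "z = ?xs ! i"
      using ex by blast
    then show "z \<le> ?xs ! (card I - 1)"
      using mono[of "card I - 1" i] assms by (simp add: not_less[symmetric])
  qed (use assms nth_in in auto)
  show ?thesis
  proof (cases "m = 0")
    case True
    then show ?thesis
      using Min Max \<open>I \<noteq> {}\<close> \<open>finite I\<close> cyclic_pred_Min[of I] by simp
  next
    case False
    have "?xs ! 0 < ?xs ! m"
      using False assms mono by auto
    then have "?xs ! m \<noteq> Min I"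
      using Min by simp
    moreover have "Max {y \<in> I. y < ?xs ! m} = ?xs ! (m - 1)"
    proof (rule Max_eqI)
      fix z assume "z \<in> {y \<in> I. y < ?xs ! m}"
      then obtain i where "i < card I" "z = ?xs ! i" "i < m"
        using ex mono assms by blast
      then show "z \<le> ?xs ! (m - 1)"
        using mono[of "m - 1" i] assms by (simp add: not_less[symmetric])
    qed (use assms nth_in False mono in auto)
    ultimately show ?thesis
      using False nth_in[OF assms(2)] by (simp add: cyclic_pred_def)
  qed
qed

section \<open>The first three guesses\<close>

lemma move_incorrect_cyclic_shift:
  assumes "finite I"
  shows "move_incorrect (cyclic_shift (card I)) I \<gamma> = \<gamma> \<circ> cyclic_pred I"
proof
  fix i
  let ?xs = "sorted_list_of_set I" and ?k = "card I"
  show "move_incorrect (cyclic_shift ?k) I \<gamma> i = (\<gamma> \<circ> cyclic_pred I) i"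
  proof (cases "i \<in> I")
    case True
    then obtain m where m: "m < ?k" "i = ?xs ! m"
      using assms by (metis in_set_conv_nth length_sorted_list_of_set set_sorted_list_of_set)
    have eq: "?xs ! a = ?xs ! b \<longleftrightarrow> a = b" if "a < ?k" "b < ?k" for a b
      using that by (intro nth_eq_iff_index_eq) auto
    \<comment> \<open>The list counts from 0 and \<open>nth_smallest\<close> from 1, so
      \<open>i\<close> is the element number \<open>m + 1\<close>. The shift reaches
      \<open>m + 1\<close> from \<open>m\<close>, or from \<open>?k\<close> if
      \<open>m = 0\<close>.\<close>
    let ?j = "if m = 0 then ?k else m"
    have "(THE j. j \<in> {1..?k} \<and> nth_smallest I (cyclic_shift ?k j) = i) = ?j"
    proof (rule the_equality)
      show "?j \<in> {1..?k} \<and> nth_smallest I (cyclic_shift ?k ?j) = i"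
        using m by (auto simp: nth_smallest_def cyclic_shift_def)
    next
      fix j
      assume j: "j \<in> {1..?k} \<and> nth_smallest I (cyclic_shift ?k j) = i"
      then have "cyclic_shift ?k j - 1 < ?k"
        by (auto simp: cyclic_shift_def)
      then have "cyclic_shift ?k j - 1 = m"
        using j m eq by (simp add: nth_smallest_def)
      then show "j = ?j"
        using j m by (auto simp: cyclic_shift_def split: if_splits)
    qed
    then show ?thesis
      using True m cyclic_pred_sorted_nth[OF assms m(1)]
      by (simp add: move_incorrect_def nth_smallest_def)
  qed (simp add: move_incorrect_def)
qed

text \<open>A single correct position leaves fewer than \<open>n\<close> wrong ones, so the
  arbitrary cycle \<open>S n\<close> is not consulted. If no position is wrong, both sides are
  \<open>\<gamma>\<close>, whatever \<open>S 0\<close> is.\<close>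

lemma next_guess_inductive_strategy:
  assumes "inductive_strategy n S" "correct_positions n \<pi> \<gamma> \<noteq> {}"
  shows "next_guess n S \<pi> \<gamma> = \<gamma> \<circ> cyclic_pred (incorrect_positions n \<pi> \<gamma>)"
proof -
  let ?I = "incorrect_positions n \<pi> \<gamma>"
  have fin: "finite ?I"
    by (simp add: incorrect_positions_def)
  show ?thesis
  proof (cases "?I = {}")
    case True
    then show ?thesis
      by (auto simp: next_guess_def move_incorrect_def)
  next
    case False
    have "?I \<subset> {1..n}"
      using assms(2) unfolding incorrect_positions_def correct_positions_def by blast
    then have "card ?I < n"
      using psubset_card_mono[of "{1..n}" ?I] by simp
    moreover have "card ?I \<ge> 1"
      using False fin by (simp add: Suc_le_eq card_gt_0_iff)
    ultimately have "S (card ?I) = cyclic_shift (card ?I)"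
      using assms(1) by (simp add: inductive_strategy_def)
    then show ?thesis
      using move_incorrect_cyclic_shift[OF fin] by (simp add: next_guess_def)
  qed
qed

lemma correct_positions_eq_all_iff:
  "correct_positions n \<pi> \<gamma> = {1..n} \<longleftrightarrow> incorrect_positions n \<pi> \<gamma> = {}"
  by (auto simp: incorrect_positions_def correct_positions_def)

text \<open>The three conditions on the right say in turn that the first guess has a hit, that the
  second is not yet the secret, and that the third is. That the first guess is not the secret
  follows from \<open>J \<noteq> {}\<close> and \<open>J \<subseteq> I\<close>.\<close>

lemma game_ends_at_3_first_hit_1_iff:
  fixes n :: nat and S :: "nat \<Rightarrow> nat \<Rightarrow> nat"
  assumes "n \<ge> 1" "inductive_strategy n S" "\<pi> permutes {1..n}"
  defines "I \<equiv> incorrect_positions n \<pi> id"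
  defines "J \<equiv> incorrect_positions n \<pi> (cyclic_pred I)"
  shows "game_ends_at n S \<pi> 3 \<and> first_hit n S \<pi> = 1 \<longleftrightarrow>
         I \<noteq> {1..n} \<and> J \<noteq> {} \<and> \<pi> = cyclic_pred I \<circ> cyclic_pred J"
proof -
  \<comment> \<open>Off \<open>I\<close> the second guess repeats the first, so a correct position
    stays correct.\<close>
  have IJ: "I \<subseteq> {1..n}" "J \<subseteq> I"
    by (auto simp: I_def J_def incorrect_positions_def correct_positions_def)
  have g2: "guess n S \<pi> 2 = cyclic_pred I"
    and g3: "guess n S \<pi> 3 = cyclic_pred I \<circ> cyclic_pred J" if "I \<noteq> {1..n}"
  proof -
    have "correct_positions n \<pi> id \<noteq> {}"
      using that by (auto simp: I_def incorrect_positions_def)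
    then show 2: "guess n S \<pi> 2 = cyclic_pred I"
      using next_guess_inductive_strategy[OF assms(2)] by (simp add: numeral_2_eq_2 I_def)
    have "J \<noteq> {1..n}"
      using that IJ by auto
    then have "correct_positions n \<pi> (cyclic_pred I) \<noteq> {}"
      by (auto simp: J_def incorrect_positions_def)
    then show "guess n S \<pi> 3 = cyclic_pred I \<circ> cyclic_pred J"
      using next_guess_inductive_strategy[OF assms(2)] 2
      by (simp add: numeral_2_eq_2 numeral_3_eq_3 J_def)
  qed
  have "correct_at n S \<pi> 1 \<subseteq> {1..n}" "I = {1..n} - correct_at n S \<pi> 1"
    by (auto simp: correct_at_def correct_positions_def I_def incorrect_positions_def)
  then have c1: "correct_at n S \<pi> 1 = {} \<longleftrightarrow> I = {1..n}"
    by blast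
  \<comment> \<open>The value of \<open>first_hit\<close> can be used only once some guess is known
    to have a hit. The complete third guess supplies one, as \<open>{1..n}\<close> is
    nonempty.\<close>
  have hit: "first_hit n S \<pi> = 1 \<longleftrightarrow> I \<noteq> {1..n}" if "correct_at n S \<pi> 3 = {1..n}"
  proof
    have "1 \<le> (3::nat) \<and> correct_at n S \<pi> 3 \<noteq> {}"
      using that assms(1) by auto
    then have "1 \<le> first_hit n S \<pi> \<and> correct_at n S \<pi> (first_hit n S \<pi>) \<noteq> {}"
      unfolding first_hit_def by (rule LeastI)
    then show "I \<noteq> {1..n}" if "first_hit n S \<pi> = 1"
      using that c1 by auto
    show "first_hit n S \<pi> = 1" if "I \<noteq> {1..n}"
      unfolding first_hit_def using that c1 by (intro Least_equality) auto
  qed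
  \<comment> \<open>Agreement on \<open>{1..n}\<close> is equality of functions, since both sides
    are the identity elsewhere.\<close>
  have eq: "correct_positions n \<pi> (cyclic_pred I \<circ> cyclic_pred J) = {1..n} \<longleftrightarrow>
            \<pi> = cyclic_pred I \<circ> cyclic_pred J"
  proof
    assume *: "correct_positions n \<pi> (cyclic_pred I \<circ> cyclic_pred J) = {1..n}"
    show "\<pi> = cyclic_pred I \<circ> cyclic_pred J"
    proof
      fix x
      show "\<pi> x = (cyclic_pred I \<circ> cyclic_pred J) x"
      proof (cases "x \<in> {1..n}")
        case True
        then have "x \<in> correct_positions n \<pi> (cyclic_pred I \<circ> cyclic_pred J)"
          using * by simp
        then show ?thesis
          by (simp add: correct_positions_def)
      next
        case False
        then have "x \<notin> I" "x \<notin> J"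
          using IJ by auto
        then show ?thesis
          using False assms(3) by (simp add: permutes_not_in)
      qed
    qed
  qed (auto simp: correct_positions_def)
  have range: "{1..<3} = {1, 2 :: nat}"
    by auto
  have end3: "game_ends_at n S \<pi> 3 \<longleftrightarrow>
              \<pi> = cyclic_pred I \<circ> cyclic_pred J \<and> I \<noteq> {} \<and> J \<noteq> {}" if "I \<noteq> {1..n}"
    using g2[OF that] g3[OF that] eq
      correct_positions_eq_all_iff[of n \<pi> id, folded I_def]
      correct_positions_eq_all_iff[of n \<pi> "cyclic_pred I", folded J_def]
    unfolding game_ends_at_def range correct_at_def by simp
  have "I = {1..n} \<Longrightarrow> \<not> (game_ends_at n S \<pi> 3 \<and> first_hit n S \<pi> = 1)"
    using hit by (auto simp: game_ends_at_def)
  moreover have "first_hit n S \<pi> = 1" if "I \<noteq> {1..n}" "game_ends_at n S \<pi> 3"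
    using hit that by (auto simp: game_ends_at_def)
  ultimately show ?thesis
    using end3 IJ by blast
qed

section \<open>Coding the secrets by pairs of sets\<close>

definition recoverable :: "nat set \<Rightarrow> nat set set" where
  "recoverable I =
     {J. J \<subseteq> I \<and> card J \<ge> 2 \<and> (\<forall>x\<in>J. cyclic_pred I (cyclic_pred J x) \<noteq> x)}"

text \<open>On \<open>I - J\<close> the secret agrees with \<open>cyclic_pred I\<close>, which has
  no fixed point in \<open>I\<close>; on \<open>J\<close> the last condition of
  \<open>recoverable\<close> excludes fixed points. This gives back \<open>I\<close>. As
  \<open>cyclic_pred I\<close> is injective, the second guess is wrong exactly where
  \<open>cyclic_pred J\<close> moves a point, which gives back \<open>J\<close>.\<close>

lemma incorrect_positions_recoverable:
  assumes "I \<subseteq> {1..n}" "J \<in> recoverable I"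
  defines "\<pi> \<equiv> cyclic_pred I \<circ> cyclic_pred J"
  shows "incorrect_positions n \<pi> id = I" "incorrect_positions n \<pi> (cyclic_pred I) = J"
    and "\<pi> permutes {1..n}"
proof -
  have J: "J \<subseteq> I" "card J \<ge> 2" and neq: "\<And>x. x \<in> J \<Longrightarrow> cyclic_pred I (cyclic_pred J x) \<noteq> x"
    using assms(2) by (auto simp: recoverable_def)
  have fin: "finite I" "finite J"
    using assms(1) J(1) by (meson finite_atLeastAtMost finite_subset)+
  have "card I \<ge> 2"
    using J fin card_mono order_trans by blast
  then have "\<pi> x \<noteq> x \<longleftrightarrow> x \<in> I" for x
    using neq[of x] cyclic_pred_neq[of I x] cyclic_pred_notin[of x I] J(1)
    by (cases "x \<in> I"; cases "x \<in> J") (auto simp: \<pi>_def)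
  moreover have "incorrect_positions n \<pi> id = {x \<in> {1..n}. \<pi> x \<noteq> x}"
    by (auto simp: incorrect_positions_def correct_positions_def)
  ultimately show "incorrect_positions n \<pi> id = I"
    using assms(1) by blast
  have "\<pi> x \<noteq> cyclic_pred I x \<longleftrightarrow> x \<in> J" for x
    using permutes_inj[OF cyclic_pred_permutes[OF fin(1)]] cyclic_pred_neq[OF J(2), of x]
    by (cases "x \<in> J") (auto simp: \<pi>_def inj_eq)
  moreover have "incorrect_positions n \<pi> (cyclic_pred I) = {x \<in> {1..n}. \<pi> x \<noteq> cyclic_pred I x}"
    by (auto simp: incorrect_positions_def correct_positions_def)
  ultimately show "incorrect_positions n \<pi> (cyclic_pred I) = J"
    using assms(1) J(1) by blast
  have "cyclic_pred I permutes {1..n}" "cyclic_pred J permutes {1..n}"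
    using cyclic_pred_permutes fin assms(1) J(1) permutes_subset by (metis order_trans)+
  then show "\<pi> permutes {1..n}"
    by (simp add: \<pi>_def permutes_compose)
qed

text \<open>If \<open>J\<close> were a singleton, \<open>cyclic_pred J\<close> would fix its
  element, and the second guess would be correct there. A fixed point of the composition in
  \<open>J\<close> would be a correct position of the first guess, against
  \<open>J \<subseteq> I\<close>.\<close>

lemma recoverable_incorrect_positions:
  fixes n :: nat and \<pi> :: "nat \<Rightarrow> nat"
  defines "I \<equiv> incorrect_positions n \<pi> id"
  defines "J \<equiv> incorrect_positions n \<pi> (cyclic_pred I)"
  assumes "J \<noteq> {}" "\<pi> = cyclic_pred I \<circ> cyclic_pred J"
  shows "J \<in> recoverable I"
proof -
  have "J \<subseteq> I" "finite J"
    by (auto simp: I_def J_def incorrect_positions_def correct_positions_def)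
  have I: "\<pi> x \<noteq> x" if "x \<in> I" for x
    using that by (auto simp: I_def incorrect_positions_def correct_positions_def)
  have J: "\<pi> x \<noteq> cyclic_pred I x" if "x \<in> J" for x
    using that by (auto simp: J_def incorrect_positions_def correct_positions_def)
  have "card J \<noteq> 1"
  proof
    assume "card J = 1"
    then obtain x where "J = {x}"
      by (auto simp: card_1_singleton_iff)
    then have "cyclic_pred J x = x"
      using cyclic_pred_in[of J x] by auto
    then have "\<pi> x = cyclic_pred I x"
      using assms(4) by (metis comp_apply)
    then show False
      using J \<open>J = {x}\<close> by blast
  qed
  moreover have "card J \<noteq> 0"
    using assms(3) \<open>finite J\<close> by simp
  ultimately have "card J \<ge> 2"
    by linarith
  moreover have "cyclic_pred I (cyclic_pred J x) \<noteq> x" if "x \<in> J" for x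
    using I[of x] that \<open>J \<subseteq> I\<close> assms(4) by (metis comp_apply subsetD)
  ultimately show ?thesis
    using \<open>J \<subseteq> I\<close> by (simp add: recoverable_def)
qed

lemma bij_betw_three_guess_secrets:
  assumes "n \<ge> 1" "inductive_strategy n S"
  shows "bij_betw (\<lambda>(I, J). cyclic_pred I \<circ> cyclic_pred J) (Sigma {I. I \<subset> {1..n}} recoverable)
           {\<pi>. \<pi> permutes {1..n} \<and> game_ends_at n S \<pi> 3 \<and> first_hit n S \<pi> = 1}"
    (is "bij_betw ?f ?B ?A")
proof -
  let ?I = "\<lambda>\<pi>. incorrect_positions n \<pi> id"
  let ?J = "\<lambda>\<pi>. incorrect_positions n \<pi> (cyclic_pred (?I \<pi>))"
  show ?thesis
  \<comment> \<open>The inverse map reads off the wrong positions of the first two guesses.\<close>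
  proof (rule bij_betw_byWitness[where f' = "\<lambda>\<pi>. (?I \<pi>, ?J \<pi>)"])
    show "\<forall>p\<in>?B. (?I (?f p), ?J (?f p)) = p"
      using incorrect_positions_recoverable by auto
    show "\<forall>\<pi>\<in>?A. ?f (?I \<pi>, ?J \<pi>) = \<pi>"
    proof
      fix \<pi>
      assume "\<pi> \<in> ?A"
      then have "\<pi> = cyclic_pred (?I \<pi>) \<circ> cyclic_pred (?J \<pi>)"
        using game_ends_at_3_first_hit_1_iff[OF assms] by blast
      then show "?f (?I \<pi>, ?J \<pi>) = \<pi>"
        by simp
    qed
    show "?f ` ?B \<subseteq> ?A"
    proof
      fix \<pi>
      assume "\<pi> \<in> ?f ` ?B"
      then obtain I J where I: "I \<subset> {1..n}" and J: "J \<in> recoverable I"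
        and \<pi>: "\<pi> = cyclic_pred I \<circ> cyclic_pred J"
        by auto
      note r = incorrect_positions_recoverable[OF psubset_imp_subset[OF I] J, folded \<pi>]
      have "J \<noteq> {}"
        using J by (auto simp: recoverable_def)
      then have "?I \<pi> \<noteq> {1..n} \<and> ?J \<pi> \<noteq> {} \<and> \<pi> = cyclic_pred (?I \<pi>) \<circ> cyclic_pred (?J \<pi>)"
        unfolding r(1) r(2) using I \<pi> by blast
      then show "\<pi> \<in> ?A"
        using game_ends_at_3_first_hit_1_iff[OF assms r(3)] r(3) by blast
    qed
    show "(\<lambda>\<pi>. (?I \<pi>, ?J \<pi>)) ` ?A \<subseteq> ?B"
    proof
      fix p
      assume "p \<in> (\<lambda>\<pi>. (?I \<pi>, ?J \<pi>)) ` ?A"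
      then obtain \<pi> where "\<pi> \<in> ?A" and p: "p = (?I \<pi>, ?J \<pi>)"
        by blast
      then have "?I \<pi> \<noteq> {1..n}" "?J \<pi> \<noteq> {}"
          "\<pi> = cyclic_pred (?I \<pi>) \<circ> cyclic_pred (?J \<pi>)"
        using game_ends_at_3_first_hit_1_iff[OF assms] by blast+
      moreover have "?I \<pi> \<subseteq> {1..n}"
        by (auto simp: incorrect_positions_def)
      ultimately show "p \<in> ?B"
        unfolding p using recoverable_incorrect_positions[of n \<pi>] by blast
    qed
  qed
qed

section \<open>Counting\<close>

text \<open>If \<open>x\<close> violates the condition, then \<open>J\<close> consists of
  \<open>y = cyclic_pred J x\<close> and \<open>x = cyclic_pred I y\<close>. Conversely, in a pair
  \<open>{y, cyclic_pred I y}\<close> the element \<open>cyclic_pred I y\<close> violates it,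
  because the predecessor map of a pair swaps its elements.\<close>

lemma recoverable_eq:
  assumes "finite I" "card I \<ge> 2"
  shows "recoverable I = {J. J \<subseteq> I \<and> card J \<ge> 2} - (\<lambda>y. {y, cyclic_pred I y}) ` I"
proof -
  have "(\<exists>x\<in>J. cyclic_pred I (cyclic_pred J x) = x) \<longleftrightarrow> J \<in> (\<lambda>y. {y, cyclic_pred I y}) ` I"
    if J: "J \<subseteq> I" "card J \<ge> 2" for J
  proof
    assume "\<exists>x\<in>J. cyclic_pred I (cyclic_pred J x) = x"
    then obtain x where x: "x \<in> J" "cyclic_pred I (cyclic_pred J x) = x"
      by blast
    then have "J = {cyclic_pred J x, cyclic_pred I (cyclic_pred J x)}"
      using cyclic_pred_cyclic_pred_eq[OF assms(1) J x] by simp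
    moreover have "cyclic_pred J x \<in> I"
      using x(1) J(1) cyclic_pred_in[of J x] assms(1) finite_subset by blast
    ultimately show "J \<in> (\<lambda>y. {y, cyclic_pred I y}) ` I"
      by (rule image_eqI)
  next
    assume "J \<in> (\<lambda>y. {y, cyclic_pred I y}) ` I"
    then obtain y where y: "y \<in> I" "J = {y, cyclic_pred I y}"
      by blast
    then have "cyclic_pred J (cyclic_pred I y) = y"
      using cyclic_pred_doubleton[OF cyclic_pred_neq[OF assms(2) y(1)]] by simp
    then show "\<exists>x\<in>J. cyclic_pred I (cyclic_pred J x) = x"
      using y(2) by auto
  qed
  then show ?thesis
    unfolding recoverable_def by blast
qed

text \<open>Two elements yield the same pair only if two steps back in \<open>I\<close> return to
  the start. By \<open>cyclic_pred_cyclic_pred_eq\<close> with \<open>J = I\<close>, this forces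
  \<open>I\<close> to have just two elements, and then both yield \<open>I\<close> itself.\<close>

lemma card_cyclic_pred_pairs:
  fixes I :: "'a::linorder set"
  assumes "finite I" "card I \<ge> 2"
  shows "card ((\<lambda>y. {y, cyclic_pred I y}) ` I) = (if card I = 2 then 1 else card I)"
proof (cases "card I = 2")
  case True
  have "{y, cyclic_pred I y} = I" if "y \<in> I" for y
    using that assms True cyclic_pred_in[of I y] cyclic_pred_neq[of I y]
    by (intro card_subset_eq) auto
  moreover have "I \<noteq> {}"
    using assms by auto
  ultimately have "(\<lambda>y. {y, cyclic_pred I y}) ` I = {I}"
    by auto
  then show ?thesis
    using True by simp
next
  case False
  have "inj_on (\<lambda>y. {y, cyclic_pred I y}) I"
  proof (rule inj_onI, rule ccontr)
    fix y z
    assume yz: "y \<in> I" "z \<in> I" "{y, cyclic_pred I y} = {z, cyclic_pred I z}" "y \<noteq> z"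
    then have "cyclic_pred I (cyclic_pred I y) = y"
      by (metis doubleton_eq_iff)
    then have "I = {cyclic_pred I y, y}"
      using cyclic_pred_cyclic_pred_eq[OF assms(1) order_refl assms(2) yz(1)] by simp
    then have "card I \<le> 2"
      by (metis card_2_iff cyclic_pred_neq[OF assms(2) yz(1)] order_refl)
    then show False
      using False assms by simp
  qed
  then show ?thesis
    using False by (simp add: card_image)
qed

lemma card_subsets_ge_2:
  assumes "finite I"
  shows "real (card {J. J \<subseteq> I \<and> card J \<ge> 2}) = 2 ^ card I - 1 - real (card I)"
proof -
  have split: "Pow I = {J. J \<subseteq> I \<and> card J \<ge> 2} \<union> ({J. J \<subseteq> I \<and> card J = 0} \<union> {J. J \<subseteq> I \<and> card J = 1})"
    by auto
  have "card (Pow I) = card {J. J \<subseteq> I \<and> card J \<ge> 2} +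
      (card {J. J \<subseteq> I \<and> card J = 0} + card {J. J \<subseteq> I \<and> card J = 1})"
    using assms unfolding split by (subst card_Un_disjoint; (subst card_Un_disjoint)?) auto
  then have "2 ^ card I = card {J. J \<subseteq> I \<and> card J \<ge> 2} + (1 + card I)"
    using n_subsets[OF assms, of 0] n_subsets[OF assms, of 1] assms by (simp add: card_Pow)
  then have "real (2 ^ card I) = real (card {J. J \<subseteq> I \<and> card J \<ge> 2} + (1 + card I))"
    by (rule arg_cong)
  then show ?thesis
    by simp
qed

text \<open>For \<open>k = card I\<close> at least 3, the \<open>2 ^ k - 1 - k\<close> subsets with
  two or more elements lose \<open>k\<close> adjacent pairs. The resulting expression is 0 for
  \<open>k = 0\<close>, as it should be, but -1 for \<open>k = 1\<close> and \<open>k = 2\<close>,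
  where the count is 0; the last summand repairs this.\<close>

lemma card_recoverable:
  assumes "finite I"
  shows "real (card (recoverable I)) =
         2 ^ card I - 1 - 2 * real (card I) + (if card I \<in> {1, 2} then 1 else 0)"
proof (cases "card I \<ge> 2")
  case True
  let ?P = "(\<lambda>y. {y, cyclic_pred I y}) ` I"
  have sub: "?P \<subseteq> {J. J \<subseteq> I \<and> card J \<ge> 2}"
    using cyclic_pred_in[OF assms] cyclic_pred_neq[OF True, symmetric] by auto
  have "card (recoverable I) = card {J. J \<subseteq> I \<and> card J \<ge> 2} - card ?P"
    unfolding recoverable_eq[OF assms True] using sub assms by (intro card_Diff_subset) auto
  moreover have "card ?P \<le> card {J. J \<subseteq> I \<and> card J \<ge> 2}"
    using sub assms by (intro card_mono) auto
  ultimately show ?thesis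
    using card_subsets_ge_2[OF assms] card_cyclic_pred_pairs[OF assms True] True
    by (auto simp: of_nat_diff)
next
  case False
  then have "recoverable I = {}"
    using card_mono[OF assms] by (fastforce simp: recoverable_def)
  moreover have "card I = 0 \<or> card I = 1"
    using False by linarith
  ultimately show ?thesis
    by auto
qed

lemma sum_Pow_card:
  fixes f :: "nat \<Rightarrow> 'a::comm_semiring_1"
  assumes "finite A"
  shows "(\<Sum>I\<in>Pow A. f (card I)) = (\<Sum>k\<le>card A. of_nat (card A choose k) * f k)"
proof -
  have "(\<Sum>I\<in>Pow A. f (card I)) = (\<Sum>k\<le>card A. \<Sum>I\<in>{I \<in> Pow A. card I = k}. f (card I))"
    using assms by (intro sum.group[symmetric]) (auto intro: card_mono)
  also have "\<dots> = (\<Sum>k\<le>card A. of_nat (card A choose k) * f k)"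
    using n_subsets[OF assms] by (intro sum.cong) auto
  finally show ?thesis .
qed

theorem theorem4p4:
  fixes n :: nat and S :: "nat \<Rightarrow> nat \<Rightarrow> nat"
  assumes "n \<ge> 4" and "inductive_strategy n S"
  shows "real (card {\<pi>. \<pi> permutes {1..n} \<and> game_ends_at n S \<pi> 3 \<and> first_hit n S \<pi> = 1}) =
           1 - 2 ^ (n + 1) + 3 ^ n + (real n)^2 / 2 + 5 * real n / 2 - real n * 2 ^ n"
proof -
  define h :: "nat \<Rightarrow> real" where
    "h k = 2 ^ k - 1 - 2 * real k + (if k \<in> {1, 2} then 1 else 0)" for k
  have fin: "finite I" if "I \<subseteq> {1..n}" for I
    using that finite_subset by blast
  have "card {\<pi>. \<pi> permutes {1..n} \<and> game_ends_at n S \<pi> 3 \<and> first_hit n S \<pi> = 1} =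
      card (Sigma {I. I \<subset> {1..n}} recoverable)"
    using bij_betw_same_card[OF bij_betw_three_guess_secrets[OF _ assms(2)]] assms(1) by simp
  also have "\<dots> = (\<Sum>I | I \<subset> {1..n}. card (recoverable I))"
  proof (rule card_SigmaI)
    have "{I. I \<subset> {1..n}} \<subseteq> Pow {1..n}"
      by auto
    then show "finite {I. I \<subset> {1..n}}"
      by (rule finite_subset) simp
    show "\<forall>I\<in>{I. I \<subset> {1..n}}. finite (recoverable I)"
    proof
      fix I assume "I \<in> {I. I \<subset> {1..n}}"
      then show "finite (recoverable I)"
        using fin[of I] by (intro finite_subset[of "recoverable I" "Pow I"]) (auto simp: recoverable_def)
    qed
  qed
  finally have "real (card {\<pi>. \<pi> permutes {1..n} \<and> game_ends_at n S \<pi> 3 \<and> first_hit n S \<pi> = 1}) =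
      (\<Sum>I | I \<subset> {1..n}. real (card (recoverable I)))"
    by simp
  \<comment> \<open>The count depends only on the size of \<open>I\<close>. Adding and subtracting
    the term of the full set allows a sum over all subsets, grouped by size with binomial
    weights.\<close>
  also have "\<dots> = (\<Sum>I\<in>Pow {1..n} - {{1..n}}. h (card I))"
    using fin card_recoverable by (intro sum.cong) (auto simp: h_def)
  also have "\<dots> = (\<Sum>I\<in>Pow {1..n}. h (card I)) - h n"
    by (subst sum_diff) auto
  also have "(\<Sum>I\<in>Pow {1..n}. h (card I)) = (\<Sum>k\<le>n. real (n choose k) * h k)"
    using sum_Pow_card[of "{1..n}" h] by simp
  also have "\<dots> = (\<Sum>k\<le>n. real (n choose k) * 2 ^ k) - (\<Sum>k\<le>n. real (n choose k))
      - 2 * (\<Sum>k\<le>n. real (k * (n choose k)))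
      + (\<Sum>k\<le>n. real (n choose k) * (if k \<in> {1, 2} then 1 else 0))"
    unfolding h_def
    by (simp add: algebra_simps sum.distrib sum_subtractf sum_distrib_left)
  finally have "real (card {\<pi>. \<pi> permutes {1..n} \<and> game_ends_at n S \<pi> 3 \<and> first_hit n S \<pi> = 1}) =
      (\<Sum>k\<le>n. real (n choose k) * 2 ^ k) - (\<Sum>k\<le>n. real (n choose k))
      - 2 * (\<Sum>k\<le>n. real (k * (n choose k)))
      + (\<Sum>k\<le>n. real (n choose k) * (if k \<in> {1, 2} then 1 else 0)) - h n" .
  \<comment> \<open>This is the binomial expansion of \<open>(2 + 1) ^ n\<close>.\<close>
  moreover have "(\<Sum>k\<le>n. real (n choose k) * 2 ^ k) = 3 ^ n"
    using binomial_ring[of "2::real" 1 n] by simp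
  moreover have "(\<Sum>k\<le>n. real (n choose k)) = 2 ^ n"
    using arg_cong[OF choose_row_sum[of n], of real] by simp
  moreover have "2 * (\<Sum>k\<le>n. real (k * (n choose k))) = real n * 2 ^ n"
  proof -
    have "(\<Sum>k\<le>n. real (k * (n choose k))) = real (n * 2 ^ (n - 1))"
      using choose_linear_sum[of n] by (metis of_nat_sum)
    moreover have "(2::real) ^ n = 2 * 2 ^ (n - 1)"
      using assms(1) by (simp flip: power_Suc)
    ultimately show ?thesis
      by simp
  qed
  \<comment> \<open>The repair for sizes 1 and 2 contributes \<open>n choose 1\<close> and
    \<open>n choose 2\<close>, the source of the quadratic term.\<close>
  moreover have "(\<Sum>k\<le>n. real (n choose k) * (if k \<in> {1, 2} then 1 else 0)) =
      real n + real n * (real n - 1) / 2"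
  proof -
    have "(\<Sum>k\<le>n. real (n choose k) * (if k \<in> {1, 2} then 1 else 0)) =
        (\<Sum>k\<in>{1, 2}. real (n choose k))"
      using assms(1) by (intro sum.mono_neutral_cong_right) auto
    also have "\<dots> = real n + real (n choose 2)"
      by simp
    also have "real (n choose 2) = real n * (real n - 1) / 2"
      using assms(1) by (simp add: choose_two real_of_nat_div of_nat_diff)
    finally show ?thesis .
  qed
  \<comment> \<open>The full set has more than two elements, so its term carries no repair.\<close>
  moreover have "h n = 2 ^ n - 1 - 2 * real n"
    using assms(1) by (simp add: h_def)
  ultimately show ?thesis
    by (simp add: field_simps power2_eq_square)
qed

end
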